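(* Let $A\in\mathbb{C}^{n\times n}$ have index $k$ and satisfy $\operatorname{rank}(A^{\sim}AA^{\sim})=\operatorname{rank}(A)$, and let $X\in\mathbb{C}^{n\times n}$. Then the following statements are equivalent: (1) $X=A^{D,\mathfrak{m}}$; (2) $\mathcal{R}(X)\subseteq\mathcal{R}(A^{k})$ and $A^{D}X=A^{D}A^{\mathfrak{m}}$; (3) $\mathcal{R}(X)\subseteq\mathcal{R}(A^{k})$ and $A^{k}X=A^{k}A^{\mathfrak{m}}$; (4) $\mathcal{N}(A^{k}A^{\mathfrak{m}})\subseteq\mathcal{N}(X)$ and $XA=AA^{D}$; (5) $\mathcal{N}(A^{k}A^{\mathfrak{m}})\subseteq\mathcal{N}(X)$ and $XA^{k+1}=A^{k}$.
   Context: $\mathcal{R}(\cdot)$ and $\mathcal{N}(\cdot)$ denote range and null space. The index of $A\in\mathbb{C}^{n\times n}$ is the smallest nonnegative integer $k$ with $\operatorname{rank}(A^{k+1})=\operatorname{rank}(A^{k})$. The Minkowski metric matrix of order $n$ is $G=\operatorname{diag}(1,-I_{n-1})$. For $A\in\mathbb{C}^{n\times n}$, the Minkowski adjoint is $A^{\sim}=GA^{*}G$, where $A^*$ is the conjugate transpose. The Drazin inverse $A^{D}$ of $A$ (of index $k$) is the unique $X$ with $XAX=X$, $AX=XA$, $A^{k+1}X=A^{k}$. The Minkowski inverse $A^{\mathfrak{m}}$ is the unique matrix $X$ (if it exists) with $AXA=A$, $XAX=X$, $(AX)^{\sim}=AX$, $(XA)^{\sim}=XA$; it exists if and only if $\operatorname{rank}(A^{\sim}AA^{\sim})=\operatorname{rank}(A)$.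 When it exists, the $\mathfrak{m}$-DMP inverse of $A$ is $A^{D,\mathfrak{m}}=A^{D}AA^{\mathfrak{m}}$. *)

theory Defs
  imports
    "Jordan_Normal_Form.DL_Rank"
    "Jordan_Normal_Form.Matrix_Kernel"
    "Jordan_Normal_Form.Schur_Decomposition"
begin

abbreviation mat_rank :: "complex mat \<Rightarrow> nat" where
  "mat_rank A \<equiv> vec_space.rank (dim_row A) A"

definition mat_range :: "complex mat \<Rightarrow> complex vec set" where
  "mat_range A = {A *\<^sub>v v | v. v \<in> carrier_vec (dim_col A)}"

lemma mat_range_eq_col_space: "mat_range A = vec_space.col_space (dim_row A) A"
  unfolding mat_range_def
  by (subst vec_space.col_space_eq[of A "dim_row A" "dim_col A"]) (auto intro: mult_mat_vec_carrier[of A "dim_row A" "dim_col A"])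

definition mat_index :: "complex mat \<Rightarrow> nat" where
  "mat_index A = (LEAST k. mat_rank (A ^\<^sub>m (k + 1)) = mat_rank (A ^\<^sub>m k))"

definition minkowski_metric :: "nat \<Rightarrow> complex mat" where
  "minkowski_metric n = mat_diag n (\<lambda>i. if i = 0 then 1 else - 1)"

definition minkowski_adjoint :: "complex mat \<Rightarrow> complex mat" where
  "minkowski_adjoint A =
     minkowski_metric (dim_row A) * mat_adjoint A * minkowski_metric (dim_row A)"

definition is_drazin_inverse :: "complex mat \<Rightarrow> complex mat \<Rightarrow> bool" where
  "is_drazin_inverse A X \<longleftrightarrow>
     X \<in> carrier_mat (dim_row A) (dim_row A) \<and>
     X * A * X = X \<and>
     A * X = X * A \<and>
     A ^\<^sub>m (mat_index A + 1) * X = A ^\<^sub>m mat_index A"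

definition drazin_inverse :: "complex mat \<Rightarrow> complex mat" where
  "drazin_inverse A = (THE X. is_drazin_inverse A X)"

definition is_minkowski_inverse :: "complex mat \<Rightarrow> complex mat \<Rightarrow> bool" where
  "is_minkowski_inverse A X \<longleftrightarrow>
     X \<in> carrier_mat (dim_row A) (dim_row A) \<and>
     A * X * A = A \<and>
     X * A * X = X \<and>
     minkowski_adjoint (A * X) = A * X \<and>
     minkowski_adjoint (X * A) = X * A"

text \<open>The value is unspecified when no Minkowski inverse exists; it exists iff
  \<open>mat_rank (minkowski_adjoint A * A * minkowski_adjoint A) = mat_rank A\<close>.\<close>

definition minkowski_inverse :: "complex mat \<Rightarrow> complex mat" where
  "minkowski_inverse A = (THE X. is_minkowski_inverse A X)"

definition m_DMP_inverse :: "complex mat \<Rightarrow> complex mat" where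
  "m_DMP_inverse A = drazin_inverse A * A * minkowski_inverse A"

end

theory Submission
  imports Defs
begin

text \<open>
  Write \<open>D\<close> for the Drazin inverse, \<open>M\<close> for the Minkowski inverse and \<open>k\<close> for the index of \<open>A\<close>.
  Once both inverses exist, each equivalence is a computation with projectors. Since
  \<open>D A = A D\<close> fixes \<open>A ^ k\<close> from either side, \<open>\<R>(X) \<subseteq> \<R>(A ^ k)\<close> forces \<open>X = D A X\<close>. Now \<open>D X\<close>
  determines \<open>A D X = D A X\<close>, and so does \<open>A ^ k X\<close>, because \<open>D A\<close> is a left multiple of \<open>A ^ k\<close>;
  replacing \<open>X\<close> by \<open>M\<close> in these products gives \<open>X = D A M\<close>. Dually, if
  \<open>\<N>(A ^ k M) \<subseteq> \<N>(X)\<close>, then \<open>X\<close> satisfies every identity \<open>X N = X\<close> for which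
  \<open>A ^ k M N = A ^ k M\<close>. Taking \<open>N = A M\<close>, or \<open>N = A D A M\<close>, turns the prescribed value of
  \<open>X A\<close>, or of \<open>X A ^ (k + 1)\<close>, into \<open>X = D A M\<close>. Lemma \<open>dmp_characterizations\<close> carries this
  out.

  As both inverses are given by definite descriptions, their existence and uniqueness have to be
  shown, and existence is where the rank enters. The tool is cancellation: if
  \<open>rank (B C) = rank B\<close>, then \<open>B\<close> and \<open>B C\<close> have the same column space, so \<open>B = B C Z\<close> for
  some \<open>Z\<close>, and transposition gives the mirror statement. At the index this yields
  \<open>A ^ k = A ^ (k + 1) Z = W A ^ (k + 1)\<close>, whence \<open>D = A ^ k Z ^ (k + 1) = W ^ (k + 1) A ^ k\<close>.
  For \<open>H\<close> the Minkowski adjoint of \<open>A\<close>, the rank hypothesis yields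
  \<open>H = H A H Y = W H A H\<close>, whence \<open>M = H Y = W H\<close>. Uniqueness is the classical algebraic
  argument in both cases.
\<close>


section \<open>Rank, column space and cancellation\<close>

lemma (in vec_space) col_space_basis:
  assumes A: "A \<in> carrier_mat n m"
  obtains b where "finite b" "b \<subseteq> col_space A" "lin_indpt b" "span b = col_space A" "card b = rank A"
proof -
  let ?S = "set (cols A)"
  have S: "?S \<subseteq> carrier_vec n" using A cols_dim[of A] by auto
  have sub: "VectorSpace.subspace class_ring (span ?S) V" using span_is_subspace[OF S] .
  interpret W: vectorspace class_ring "span_vs ?S" using subspace_is_vs[OF sub] .
  have fd: "W.fin_dim" using fin_dim_span_cols[OF A] .
  obtain b where b: "finite b" "W.basis b" using W.finite_basis_exists[OF fd] by auto
  have bW: "b \<subseteq> span ?S" using b(2) unfolding W.basis_def by auto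
  have sm: "submodule class_ring (span ?S) V" using sub unfolding VectorSpace.subspace_def by auto
  have "lin_indpt b" using span_li_not_depend(2)[OF bW sm] b(2) unfolding W.basis_def by auto
  moreover have "span b = span ?S" using span_li_not_depend(1)[OF bW sm] b(2)
    unfolding W.basis_def by auto
  moreover have "card b = rank A" unfolding rank_def using W.dim_basis[OF b] by simp
  ultimately show ?thesis using that b bW unfolding col_space_def by blast
qed

text \<open>A basis of the smaller column space is linearly independent in the larger one, and it spans the
  larger one as soon as it has enough elements.\<close>

lemma (in vec_space) rank_le_if_col_space_subset:
  assumes A: "A \<in> carrier_mat n m" and B: "B \<in> carrier_mat n m'"
    and sub: "col_space A \<subseteq> col_space B"
  shows "rank A \<le> rank B" and "rank A = rank B \<Longrightarrow> col_space A = col_space B"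
proof -
  obtain b where b: "finite b" "b \<subseteq> col_space A" "lin_indpt b" "span b = col_space A" "card b = rank A"
    using col_space_basis[OF A] .
  let ?S = "set (cols B)"
  have S: "?S \<subseteq> carrier_vec n" using B cols_dim[of B] by auto
  have sp: "VectorSpace.subspace class_ring (span ?S) V" using span_is_subspace[OF S] .
  interpret W: vectorspace class_ring "span_vs ?S" using subspace_is_vs[OF sp] .
  have fd: "W.fin_dim" using fin_dim_span_cols[OF B] .
  have sm: "submodule class_ring (span ?S) V" using sp unfolding VectorSpace.subspace_def by auto
  have bW: "b \<subseteq> span ?S" using b(2) sub unfolding col_space_def by auto
  hence bc: "b \<subseteq> carrier (span_vs ?S)" by simp
  have li: "W.lin_indpt b" using span_li_not_depend(2)[OF bW sm] b(3) by auto
  show "rank A \<le> rank B" unfolding b(5)[symmetric] rank_def[of B] using W.li_le_dim(2)[OF fd bc li] .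
  assume "rank A = rank B"
  hence "W.dim \<le> card b" using b(5) unfolding rank_def[of B] by simp
  hence "W.basis b" using W.dim_li_is_basis[OF fd b(1) bc li] by simp
  hence "span b = span ?S" using span_li_not_depend(1)[OF bW sm] unfolding W.basis_def by auto
  thus "col_space A = col_space B" using b(4) unfolding col_space_def by simp
qed

lemma mult_mat_unit_vec:
  fixes A :: "complex mat"
  assumes "A \<in> carrier_mat n m" "j < m"
  shows "A *\<^sub>v unit_vec m j = col A j"
  using assms by (intro eq_vecI) (auto simp: scalar_prod_right_unit[of _ m])

text \<open>The columns of \<open>Z\<close> are preimages under \<open>B\<close> of the columns of \<open>A\<close>.\<close>

lemma mat_range_subset_imp_factor:
  assumes A: "A \<in> carrier_mat n m" and B: "B \<in> carrier_mat n p"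
    and sub: "mat_range A \<subseteq> mat_range B"
  obtains Z where "Z \<in> carrier_mat p m" "A = B * Z"
proof -
  have "\<exists>v. v \<in> carrier_vec p \<and> col A j = B *\<^sub>v v" if j: "j < m" for j
  proof -
    have "col A j \<in> mat_range A" 
      using A mult_mat_unit_vec[OF A j] unfolding mat_range_def
      by (intro CollectI exI[of _ "unit_vec m j"]) auto
    with sub B show ?thesis unfolding mat_range_def by auto
  qed
  then obtain z where z: "\<And>j. j < m \<Longrightarrow> z j \<in> carrier_vec p \<and> col A j = B *\<^sub>v z j" by metis
  define Z where "Z = mat_of_cols p (map z [0..<m])"
  have Z: "Z \<in> carrier_mat p m" unfolding Z_def by (auto simp: mat_of_cols_def)
  have "col Z j = z j" if "j < m" for j
    unfolding Z_def using that z by (subst col_mat_of_cols) auto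
  hence "A = B * Z" using A B Z z by (intro mat_col_eqI) auto
  with Z that show ?thesis by blast
qed

lemma mat_range_mult_subset:
  assumes B: "B \<in> carrier_mat n p" and C: "C \<in> carrier_mat p m"
  shows "mat_range (B * C) \<subseteq> mat_range B"
proof
  fix y assume "y \<in> mat_range (B * C)"
  then obtain v where v: "v \<in> carrier_vec m" "y = B * C *\<^sub>v v" using C unfolding mat_range_def by auto
  hence "y = B *\<^sub>v (C *\<^sub>v v)" "C *\<^sub>v v \<in> carrier_vec p" using B C by auto
  thus "y \<in> mat_range B" using B unfolding mat_range_def by auto
qed

lemma mat_rank_mult_le:
  assumes B: "B \<in> carrier_mat n p" and C: "C \<in> carrier_mat p m"
  shows "mat_rank (B * C) \<le> mat_rank B"
  using vec_space.rank_le_if_col_space_subset(1)[of "B * C" n m B p] mat_range_mult_subset[OF assms]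
    assms by (simp add: mat_range_eq_col_space)

text \<open>Equal rank makes the inclusion \<open>\<R>(B C) \<subseteq> \<R>(B)\<close> an equality, so \<open>B\<close> factors through \<open>B C\<close>.
  This is the step that turns rank hypotheses into matrix equations.\<close>

lemma right_factor_if_rank_mult_eq:
  assumes B: "B \<in> carrier_mat n p" and C: "C \<in> carrier_mat p m"
    and eq: "mat_rank (B * C) = mat_rank B"
  obtains Z where "Z \<in> carrier_mat m p" "B = B * C * Z"
proof (rule mat_range_subset_imp_factor)
  show "B \<in> carrier_mat n p" "B * C \<in> carrier_mat n m" using assms by auto
  show "mat_range B \<subseteq> mat_range (B * C)"
    using vec_space.rank_le_if_col_space_subset(2)[of "B * C" n m B p] mat_range_mult_subset[OF B C]
      assms by (simp add: mat_range_eq_col_space)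
qed (use that in blast)

text \<open>Full-rank factorization: the columns of \<open>B\<close> form a basis of the column space of \<open>A\<close>. It shows
  that an operation reversing products cannot increase the rank.\<close>

lemma rank_factorization:
  assumes A: "A \<in> carrier_mat n m"
  obtains B C where "B \<in> carrier_mat n (mat_rank A)" "C \<in> carrier_mat (mat_rank A) m" "A = B * C"
proof -
  have dA: "dim_row A = n" using A by simp
  interpret vec_space "TYPE(complex)" n .
  obtain b where b: "finite b" "b \<subseteq> col_space A" "lin_indpt b" "span b = col_space A" "card b = rank A"
    using col_space_basis[OF A] .
  obtain bs where bs: "set bs = b" "distinct bs" using finite_distinct_list[OF b(1)] by auto
  have len: "length bs = rank A" using bs b(5) distinct_card[of bs] by simp
  define B where "B = mat_of_cols n bs"
  have B: "B \<in> carrier_mat n (rank A)" unfolding B_def using len by (auto simp: mat_of_cols_def)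
  have "col_space A \<subseteq> carrier V" using col_space_eq[OF A] dA by auto
  hence bc: "b \<subseteq> carrier_vec n" using b(2) by auto
  hence "cols B = bs" unfolding B_def using bs by (intro cols_mat_of_cols) auto
  hence "col_space B = col_space A" using bs b(4) unfolding col_space_def by simp
  hence "mat_range A \<subseteq> mat_range B" using A B by (simp add: mat_range_eq_col_space)
  from mat_range_subset_imp_factor[OF A B this] B that show ?thesis unfolding dA by blast
qed

lemma mat_rank_mult_le_inner:
  assumes B: "B \<in> carrier_mat n p" and C: "C \<in> carrier_mat p m"
  shows "mat_rank (B * C) \<le> p"
  using mat_rank_mult_le[OF assms] vec_space.rank_le_nc[OF B] B by simp

text \<open>The transpose of a full-rank factorization has the same inner dimension; applying this twice gives
  equality.\<close>

lemma mat_rank_transpose: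
  assumes A: "A \<in> carrier_mat n m"
  shows "mat_rank A\<^sup>T = mat_rank A"
proof -
  have le: "mat_rank M\<^sup>T \<le> mat_rank M" if M: "M \<in> carrier_mat r c" for M r c
  proof -
    obtain B C where BC: "B \<in> carrier_mat r (mat_rank M)" "C \<in> carrier_mat (mat_rank M) c"
      and eq: "M = B * C" using rank_factorization[OF M] .
    have "M\<^sup>T = C\<^sup>T * B\<^sup>T" using eq transpose_mult[OF BC] by simp
    thus ?thesis using mat_rank_mult_le_inner[of "C\<^sup>T" c "mat_rank M" "B\<^sup>T" r] BC by simp
  qed
  have "A\<^sup>T \<in> carrier_mat m n" using A by simp
  from le[OF this] le[OF A] show ?thesis by simp
qed

lemma left_factor_if_rank_mult_eq:
  assumes B: "B \<in> carrier_mat p n" and C: "C \<in> carrier_mat m p"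
    and eq: "mat_rank (C * B) = mat_rank B"
  obtains W where "W \<in> carrier_mat p m" "B = W * (C * B)"
proof -
  have tr: "(C * B)\<^sup>T = B\<^sup>T * C\<^sup>T" by (rule transpose_mult[OF C B])
  have CB: "C * B \<in> carrier_mat m n" using B C by simp
  have "mat_rank (B\<^sup>T * C\<^sup>T) = mat_rank B\<^sup>T"
    using mat_rank_transpose[OF CB] mat_rank_transpose[OF B] eq tr by metis
  then obtain Z where Z: "Z \<in> carrier_mat m p" "B\<^sup>T = B\<^sup>T * C\<^sup>T * Z"
    using right_factor_if_rank_mult_eq[of "B\<^sup>T" n p "C\<^sup>T" m] B C by auto
  hence "B\<^sup>T = (C * B)\<^sup>T * Z" using tr by simp
  hence "B = Z\<^sup>T * (C * B)"
    using transpose_mult[of "(C * B)\<^sup>T" n m Z p] CB Z(1) transpose_transpose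
    by (metis transpose_carrier_mat)
  with Z(1) that[of "Z\<^sup>T"] show ?thesis by simp
qed


section \<open>Existence and uniqueness of the Drazin inverse\<close>

lemma pow_mat_add:
  fixes A :: "complex mat"
  assumes A: "A \<in> carrier_mat n n"
  shows "A ^\<^sub>m (i + j) = A ^\<^sub>m i * A ^\<^sub>m j"
proof (induction j)
  case (Suc j)
  thus ?case using A by (simp add: assoc_mult_mat[of _ n n _ n _ n] mult_carrier_mat[of _ n n _ n])
qed (use A in simp)

lemma pow_mat_commute:
  fixes A :: "complex mat"
  assumes A: "A \<in> carrier_mat n n" and D: "D \<in> carrier_mat n n" and c: "A * D = D * A"
  shows "A ^\<^sub>m i * D = D * A ^\<^sub>m i"
proof (induction i)
  case (Suc i)
  have "A ^\<^sub>m Suc i * D = A ^\<^sub>m i * D * A"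
    using A D c by (simp add: assoc_mult_mat[of _ n n _ n _ n] mult_carrier_mat[of _ n n _ n])
  also have "\<dots> = D * A ^\<^sub>m Suc i"
    using A D Suc by (simp add: assoc_mult_mat[of _ n n _ n _ n] mult_carrier_mat[of _ n n _ n])
  finally show ?case .
qed (use A D in simp)

text \<open>One relation \<open>A ^ k = A ^ (k + 1) Z\<close> can be iterated, although \<open>Z\<close> need not commute with \<open>A\<close>:
  the middle factor \<open>A ^ (k + 1) Z\<close> of \<open>A ^ (k + 1 + m) Z ^ (m + 1)\<close> collapses to \<open>A ^ k\<close>.\<close>

lemma pow_mat_right_descent:
  fixes A :: "complex mat"
  assumes A: "A \<in> carrier_mat n n" and Z: "Z \<in> carrier_mat n n"
    and eq: "A ^\<^sub>m k = A ^\<^sub>m (k + 1) * Z"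
  shows "A ^\<^sub>m k = A ^\<^sub>m (k + m) * Z ^\<^sub>m m"
proof (induction m)
  case (Suc m)
  have e1: "A ^\<^sub>m (k + Suc m) = A ^\<^sub>m m * A ^\<^sub>m (k + 1)"
    using pow_mat_add[OF A, of m "k + 1"] by (simp add: ac_simps)
  have e2: "Z ^\<^sub>m Suc m = Z * Z ^\<^sub>m m" using pow_mat_add[OF Z, of 1 m] Z by simp
  have "A ^\<^sub>m (k + Suc m) * Z ^\<^sub>m Suc m = A ^\<^sub>m m * (A ^\<^sub>m (k + 1) * Z) * Z ^\<^sub>m m"
    unfolding e1 e2 using A Z by (simp add: assoc_mult_mat[of _ n n _ n _ n] mult_carrier_mat[of _ n n _ n] del: pow_mat.simps)
  also have "\<dots> = A ^\<^sub>m (k + m) * Z ^\<^sub>m m"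
    unfolding eq[symmetric] using pow_mat_add[OF A, of m k] by (simp add: ac_simps)
  finally show ?case using Suc by simp
qed (use A Z in simp)

lemma pow_mat_left_descent:
  fixes A :: "complex mat"
  assumes A: "A \<in> carrier_mat n n" and W: "W \<in> carrier_mat n n"
    and eq: "A ^\<^sub>m k = W * A ^\<^sub>m (k + 1)"
  shows "A ^\<^sub>m k = W ^\<^sub>m m * A ^\<^sub>m (k + m)"
proof (induction m)
  case (Suc m)
  have e1: "A ^\<^sub>m (k + Suc m) = A ^\<^sub>m (k + 1) * A ^\<^sub>m m"
    using pow_mat_add[OF A, of "k + 1" m] by (simp add: ac_simps)
  have "W ^\<^sub>m Suc m * A ^\<^sub>m (k + Suc m) = W ^\<^sub>m m * (W * A ^\<^sub>m (k + 1)) * A ^\<^sub>m m"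
    unfolding e1 pow_mat.simps(2)[of W] using A W
    by (simp add: assoc_mult_mat[of _ n n _ n _ n] mult_carrier_mat[of _ n n _ n] del: pow_mat.simps)
  also have "\<dots> = W ^\<^sub>m m * A ^\<^sub>m (k + m)"
    unfolding eq[symmetric] using pow_mat_add[OF A, of k m] A W
    by (simp add: assoc_mult_mat[of _ n n _ n _ n] mult_carrier_mat[of _ n n _ n])
  finally show ?case using Suc by simp
qed (use A W in simp)

text \<open>The ranks of the powers form a nonincreasing sequence of natural numbers, so two neighbours
  coincide and the least such position is attained.\<close>

lemma mat_rank_pow_mat_index:
  assumes A: "A \<in> carrier_mat n n"
  shows "mat_rank (A ^\<^sub>m (mat_index A + 1)) = mat_rank (A ^\<^sub>m mat_index A)"
proof -
  let ?f = "\<lambda>k. mat_rank (A ^\<^sub>m k)"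
  have dec: "?f (k + 1) \<le> ?f k" for k
    using mat_rank_mult_le[of "A ^\<^sub>m k" n n A n] A by simp
  have "\<exists>k. ?f (k + 1) = ?f k"
  proof (rule ccontr)
    assume "\<nexists>k. ?f (k + 1) = ?f k"
    hence less: "?f (k + 1) < ?f k" for k using dec le_neq_implies_less by blast
    \<comment> \<open>A strict decrease at every step would exhaust the initial rank.\<close>
    have "?f k + k \<le> ?f 0" for k
    proof (induction k)
      case (Suc k)
      thus ?case using less[of k] by simp
    qed simp
    from this[of "?f 0 + 1"] show False by simp
  qed
  thus ?thesis unfolding mat_index_def by (rule LeastI_ex)
qed

text \<open>With \<open>Q = A ^ (2 k + 1)\<close>, the descent lemmas give \<open>A ^ k = Q S = T Q\<close>. Hence
  \<open>D = A ^ k S = T Q S = T A ^ k\<close>, and having both a left and a right expression for \<open>D\<close> replaces the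
  missing commutation of \<open>S\<close> and \<open>T\<close> with \<open>A\<close>.\<close>

lemma is_drazin_inverse_exists:
  assumes A: "A \<in> carrier_mat n n"
  shows "\<exists>D. is_drazin_inverse A D"
proof -
  define k where "k = mat_index A"
  note [simp] = assoc_mult_mat[of _ n n _ n _ n] mult_carrier_mat[of _ n n _ n]
  have rk: "mat_rank (A ^\<^sub>m (k + 1)) = mat_rank (A ^\<^sub>m k)"
    using mat_rank_pow_mat_index[OF A] unfolding k_def .
  have P: "A ^\<^sub>m k \<in> carrier_mat n n" using A by simp
  have r: "A ^\<^sub>m (k + 1) = A ^\<^sub>m k * A" and l: "A ^\<^sub>m (k + 1) = A * A ^\<^sub>m k"
    using pow_mat_commute[OF A A refl, of k] by simp_all
  obtain Z where Z: "Z \<in> carrier_mat n n" "A ^\<^sub>m k = A ^\<^sub>m (k + 1) * Z"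
    using right_factor_if_rank_mult_eq[OF P A] rk r by auto
  obtain W where W: "W \<in> carrier_mat n n" "A ^\<^sub>m k = W * A ^\<^sub>m (k + 1)"
    using left_factor_if_rank_mult_eq[OF P A] rk l by auto
  define S where "S = Z ^\<^sub>m (k + 1)"
  define T where "T = W ^\<^sub>m (k + 1)"
  have S: "S \<in> carrier_mat n n" and T: "T \<in> carrier_mat n n" unfolding S_def T_def using Z(1) W(1) by simp_all
  define Q where "Q = A ^\<^sub>m (k + (k + 1))"
  have Q: "Q \<in> carrier_mat n n" unfolding Q_def using A by simp
  have QS: "A ^\<^sub>m k = Q * S" unfolding Q_def S_def by (rule pow_mat_right_descent[OF A Z])
  have TQ: "A ^\<^sub>m k = T * Q" unfolding Q_def T_def by (rule pow_mat_left_descent[OF A W])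
  have Q1: "Q = A ^\<^sub>m k * (A * A ^\<^sub>m k)" unfolding Q_def by (metis l pow_mat_add[OF A])
  have Q2: "Q = A ^\<^sub>m (k + 1) * A ^\<^sub>m k" unfolding Q1 r using A by simp
  have AQ: "A * Q = Q * A"  unfolding Q_def by (rule pow_mat_commute[OF A A refl, symmetric])
  define D where "D = A ^\<^sub>m k * S"
  have D: "D \<in> carrier_mat n n" unfolding D_def using A S by simp
  have "D = T * Q * S" unfolding D_def TQ ..
  also have "\<dots> = T * (Q * S)" using T Q S by simp
  finally have D': "D = T * A ^\<^sub>m k" unfolding QS[symmetric] .
  have "A * D = A ^\<^sub>m k * A * S" unfolding D_def r[symmetric] l using A S by simp
  also have "\<dots> = T * (Q * A) * S" unfolding TQ using A T Q S by simp
  also have "\<dots> = T * A * (Q * S)" unfolding AQ[symmetric] using A T Q S by simp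
  also have "\<dots> = T * (A * A ^\<^sub>m k)" unfolding QS[symmetric] using A T by simp
  also have "\<dots> = D * A" unfolding D' l[symmetric] r using A T by simp
  finally have c: "A * D = D * A" .
  have "A ^\<^sub>m (k + 1) * D = Q * S" unfolding Q2 D_def using A S P by (simp del: pow_mat.simps)
  hence ind: "A ^\<^sub>m (k + 1) * D = A ^\<^sub>m k" using QS by simp
  have "D * A * D = T * A ^\<^sub>m k * A * (A ^\<^sub>m k * S)" unfolding D_def[symmetric] D'[symmetric] ..
  also have "\<dots> = T * Q * S" unfolding Q1 using A S T by simp
  also have "\<dots> = D" unfolding TQ[symmetric] D_def ..
  finally have "D * A * D = D" .
  with c ind D A show ?thesis unfolding is_drazin_inverse_def k_def by auto
qed

text \<open>Commutation turns \<open>D A D = D\<close> into \<open>A D D = D\<close>, so a further factor \<open>A D\<close> may be inserted at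
  will. Thus \<open>D\<close> is divisible by every power of \<open>A\<close>.\<close>

lemma commuting_outer_inverse_pow:
  fixes A :: "complex mat"
  assumes A: "A \<in> carrier_mat n n" and D: "D \<in> carrier_mat n n"
    and outer: "D * A * D = D" and c: "A * D = D * A"
  shows "D = A ^\<^sub>m m * D ^\<^sub>m (m + 1)"
proof (induction m)
  case (Suc m)
  note [simp] = assoc_mult_mat[of _ n n _ n _ n] mult_carrier_mat[of _ n n _ n]
  have DD: "A * D * D = D" using outer c by simp
  have e: "D ^\<^sub>m (Suc m + 1) = D * D ^\<^sub>m (m + 1)"
    using pow_mat_commute[OF D D refl, of "m + 1"] by simp
  have e': "D ^\<^sub>m (m + 1) = D * D ^\<^sub>m m" using pow_mat_commute[OF D D refl, of m] by simp
  have "A ^\<^sub>m Suc m * D ^\<^sub>m (Suc m + 1) = A ^\<^sub>m m * (A * D * D * D ^\<^sub>m m)"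
    unfolding e e' using A D by simp
  also have "\<dots> = A ^\<^sub>m m * D ^\<^sub>m (m + 1)" unfolding DD e' ..
  finally show ?case using Suc by simp
qed (use A D in simp)

text \<open>Both \<open>D\<close> and \<open>E\<close> equal \<open>D A E\<close>: write \<open>E\<close> with a left factor \<open>A ^ k\<close>, which \<open>D A\<close> fixes,
  and \<open>D\<close> with a right factor \<open>A ^ k\<close>, which \<open>A E\<close> fixes.\<close>

lemma is_drazin_inverse_unique:
  assumes A: "A \<in> carrier_mat n n" and D: "is_drazin_inverse A D" and E: "is_drazin_inverse A E"
  shows "D = E"
proof -
  define k where "k = mat_index A"
  note [simp] = assoc_mult_mat[of _ n n _ n _ n] mult_carrier_mat[of _ n n _ n]
  have Dc: "D \<in> carrier_mat n n" and cD: "A * D = D * A" and oD: "D * A * D = D"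
    and iD: "A ^\<^sub>m (k + 1) * D = A ^\<^sub>m k"
    and Ec: "E \<in> carrier_mat n n" and cE: "A * E = E * A" and oE: "E * A * E = E"
    and iE: "A ^\<^sub>m (k + 1) * E = A ^\<^sub>m k"
    using D E A unfolding is_drazin_inverse_def k_def by auto
  have DA: "D = D ^\<^sub>m (k + 1) * A ^\<^sub>m k"
  proof -
    have "A * D ^\<^sub>m (k + 1) = D ^\<^sub>m (k + 1) * A"
      by (rule pow_mat_commute[OF Dc A cD[symmetric], symmetric])
    from pow_mat_commute[OF A _ this, of k] show ?thesis
      using commuting_outer_inverse_pow[OF A Dc oD cD, of k] Dc by simp
  qed
  have AE: "E = A ^\<^sub>m k * E ^\<^sub>m (k + 1)" by (rule commuting_outer_inverse_pow[OF A Ec oE cE])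
  have ADk: "A ^\<^sub>m k = D * A * A ^\<^sub>m k"
    using iD pow_mat_commute[OF A Dc cD, of "k + 1"] pow_mat_commute[OF A A refl, of k] A Dc by simp
  have "D * A * E = D * A * (A ^\<^sub>m k * E ^\<^sub>m (k + 1))" using AE by simp
  also have "\<dots> = D * A * A ^\<^sub>m k * E ^\<^sub>m (k + 1)" using A Dc Ec by (simp del: pow_mat.simps)
  finally have "D * A * E = E" unfolding ADk[symmetric] AE[symmetric] .
  have "D * A * E = D ^\<^sub>m (k + 1) * A ^\<^sub>m k * A * E" using DA by simp
  also have "\<dots> = D ^\<^sub>m (k + 1) * (A ^\<^sub>m (k + 1) * E)" using A Dc Ec by simp
  finally have "D * A * E = D" unfolding iE DA[symmetric] .
  with \<open>D * A * E = E\<close> show ?thesis by simp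
qed

lemma is_drazin_inverse_drazin_inverse:
  assumes "A \<in> carrier_mat n n"
  shows "is_drazin_inverse A (drazin_inverse A)"
  unfolding drazin_inverse_def
  using is_drazin_inverse_exists[OF assms] is_drazin_inverse_unique[OF assms] by (metis theI)

section \<open>The Minkowski adjoint\<close>

lemma mat_adjoint_carrier:
  "A \<in> carrier_mat n m \<Longrightarrow> mat_adjoint A \<in> carrier_mat m n"
  unfolding mat_adjoint_def by (auto simp: mat_of_rows_def)

lemma mat_adjoint_index:
  assumes "i < dim_col A" "j < dim_row A"
  shows "mat_adjoint A $$ (i, j) = conjugate (A $$ (j, i))"
  using assms unfolding mat_adjoint_def by (simp add: mat_of_rows_index)

lemma mat_adjoint_mult:
  fixes A B :: "complex mat"
  assumes A: "A \<in> carrier_mat n m" and B: "B \<in> carrier_mat m p"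
  shows "mat_adjoint (A * B) = mat_adjoint B * mat_adjoint A"
proof (rule eq_matI)
  have c: "mat_adjoint A \<in> carrier_mat m n" "mat_adjoint B \<in> carrier_mat p m"
    "mat_adjoint (A * B) \<in> carrier_mat p n" using A B by (auto intro!: mat_adjoint_carrier)
  show "dim_row (mat_adjoint (A * B)) = dim_row (mat_adjoint B * mat_adjoint A)"
    "dim_col (mat_adjoint (A * B)) = dim_col (mat_adjoint B * mat_adjoint A)" using c by auto
  fix i j assume "i < dim_row (mat_adjoint B * mat_adjoint A)" "j < dim_col (mat_adjoint B * mat_adjoint A)"
  hence "i < p" "j < n" using c by auto
  thus "mat_adjoint (A * B) $$ (i, j) = (mat_adjoint B * mat_adjoint A) $$ (i, j)"
    using A B c by (simp add: mat_adjoint_index scalar_prod_def mult.commute)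
qed

lemma mat_adjoint_adjoint:
  fixes A :: "complex mat"
  assumes A: "A \<in> carrier_mat n m"
  shows "mat_adjoint (mat_adjoint A) = A"
proof -
  have c: "mat_adjoint A \<in> carrier_mat m n" "mat_adjoint (mat_adjoint A) \<in> carrier_mat n m"
    using A by (auto intro!: mat_adjoint_carrier)
  show ?thesis by (rule eq_matI) (use A c in \<open>auto simp: mat_adjoint_index\<close>)
qed

lemma minkowski_metric_carrier: "minkowski_metric n \<in> carrier_mat n n"
  unfolding minkowski_metric_def by simp

lemma minkowski_metric_square: "minkowski_metric n * minkowski_metric n = 1\<^sub>m n"
proof -
  have "(\<lambda>i. (if i = 0 then 1 else - 1) * (if i = 0 then 1 else - 1)) = (\<lambda>i::nat. 1 :: complex)" by auto
  thus ?thesis unfolding minkowski_metric_def mat_diag_diag by simp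
qed

lemma mat_adjoint_minkowski_metric: "mat_adjoint (minkowski_metric n) = minkowski_metric n"
proof -
  have c: "minkowski_metric n \<in> carrier_mat n n" by (rule minkowski_metric_carrier)
  show ?thesis
    by (rule eq_matI) (use c mat_adjoint_carrier[OF c] in
        \<open>auto simp: mat_adjoint_index minkowski_metric_def mat_diag_def\<close>)
qed

lemma minkowski_adjoint_eq:
  "A \<in> carrier_mat n n \<Longrightarrow>
     minkowski_adjoint A = minkowski_metric n * mat_adjoint A * minkowski_metric n"
  unfolding minkowski_adjoint_def by simp

lemma minkowski_adjoint_carrier:
  "A \<in> carrier_mat n n \<Longrightarrow> minkowski_adjoint A \<in> carrier_mat n n"
  using minkowski_metric_carrier[of n] mat_adjoint_carrier[of A n n] by (simp add: minkowski_adjoint_eq)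

text \<open>Between the two adjoints the metric occurs twice in a row, and it is an involution.\<close>

lemma minkowski_adjoint_mult:
  assumes A: "A \<in> carrier_mat n n" and B: "B \<in> carrier_mat n n"
  shows "minkowski_adjoint (A * B) = minkowski_adjoint B * minkowski_adjoint A"
proof -
  let ?G = "minkowski_metric n"
  note [simp] = assoc_mult_mat[of _ n n _ n _ n] mult_carrier_mat[of _ n n _ n]
  note c = A B mat_adjoint_carrier[OF A] mat_adjoint_carrier[OF B] minkowski_metric_carrier[of n]
  have "minkowski_adjoint B * minkowski_adjoint A =
      ?G * (mat_adjoint B * ((?G * ?G) * (mat_adjoint A * ?G)))"
    using c by (simp add: minkowski_adjoint_eq)
  also have "\<dots> = ?G * (mat_adjoint B * mat_adjoint A) * ?G"
    unfolding minkowski_metric_square using c by simp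
  also have "\<dots> = minkowski_adjoint (A * B)"
    using mat_adjoint_mult[OF A B] minkowski_adjoint_eq[of "A * B" n] A B by simp
  finally show ?thesis ..
qed

lemma minkowski_adjoint_adjoint:
  assumes A: "A \<in> carrier_mat n n"
  shows "minkowski_adjoint (minkowski_adjoint A) = A"
proof -
  let ?G = "minkowski_metric n"
  note [simp] = assoc_mult_mat[of _ n n _ n _ n] mult_carrier_mat[of _ n n _ n]
  note c = A mat_adjoint_carrier[OF A] minkowski_metric_carrier[of n]
  have "mat_adjoint (?G * mat_adjoint A * ?G) = ?G * A * ?G"
    using c by (simp add: mat_adjoint_mult[of _ n n _ n] mat_adjoint_adjoint[OF A] mat_adjoint_minkowski_metric)
  hence "minkowski_adjoint (minkowski_adjoint A) = ?G * (?G * A * ?G) * ?G"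
    using minkowski_adjoint_eq[OF minkowski_adjoint_carrier[OF A]] minkowski_adjoint_eq[OF A] by simp
  also have "\<dots> = (?G * ?G) * (A * (?G * ?G))" using c by simp
  also have "\<dots> = A" unfolding minkowski_metric_square using A by simp
  finally show ?thesis .
qed

text \<open>As for the transpose: the adjoint reverses a full-rank factorization, with the outer metric
  factors absorbed on either side.\<close>

lemma mat_rank_minkowski_adjoint:
  assumes A: "A \<in> carrier_mat n n"
  shows "mat_rank (minkowski_adjoint A) = mat_rank A"
proof -
  have le: "mat_rank (minkowski_adjoint M) \<le> mat_rank M" if M: "M \<in> carrier_mat n n" for M
  proof -
    let ?G = "minkowski_metric n"
    define r where "r = mat_rank M"
    obtain B C where BC: "B \<in> carrier_mat n r" "C \<in> carrier_mat r n" and eq: "M = B * C"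
      using rank_factorization[OF M] unfolding r_def .
    note c = mat_adjoint_carrier[OF BC(1)] mat_adjoint_carrier[OF BC(2)] minkowski_metric_carrier[of n]
    have "mat_adjoint M = mat_adjoint C * mat_adjoint B" using mat_adjoint_mult[OF BC] eq by simp
    hence "minkowski_adjoint M = (?G * mat_adjoint C) * (mat_adjoint B * ?G)"
      using c M by (simp add: minkowski_adjoint_eq assoc_mult_mat[of _ n n _ r _ n]
        assoc_mult_mat[of _ n r _ n _ n] assoc_mult_mat[of _ n n _ n _ n]
        mult_carrier_mat[of _ n r] mult_carrier_mat[of _ r n])
    thus ?thesis
      using mat_rank_mult_le_inner[of "?G * mat_adjoint C" n r "mat_adjoint B * ?G" n] c
      unfolding r_def[symmetric] by simp
  qed
  from le[OF minkowski_adjoint_carrier[OF A]] le[OF A] show ?thesis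
    by (simp add: minkowski_adjoint_adjoint[OF A])
qed

section \<open>Existence and uniqueness of the Minkowski inverse\<close>

text \<open>The candidate \<open>X = W H = H Y\<close> satisfies \<open>H A X = H = X A H\<close> by construction. Taking adjoints
  of these relations yields first that \<open>A X\<close> and \<open>X A\<close> are self-adjoint and then \<open>A X A = A\<close>.
  The adjoint of the indefinite form enters only as an involution reversing products; no
  positivity is available, and the rank hypothesis takes its place.\<close>

lemma is_minkowski_inverse_exists:
  assumes A: "A \<in> carrier_mat n n"
    and rank: "mat_rank (minkowski_adjoint A * A * minkowski_adjoint A) = mat_rank A"
  shows "\<exists>M. is_minkowski_inverse A M"
proof -
  note [simp] = assoc_mult_mat[of _ n n _ n _ n] mult_carrier_mat[of _ n n _ n]
  define H where "H = minkowski_adjoint A"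
  have H: "H \<in> carrier_mat n n" unfolding H_def by (rule minkowski_adjoint_carrier[OF A])
  have HA: "minkowski_adjoint H = A" unfolding H_def by (rule minkowski_adjoint_adjoint[OF A])
  have rk: "mat_rank (H * A * H) = mat_rank H"
    using rank mat_rank_minkowski_adjoint[OF A] unfolding H_def by simp
  obtain Y where Y: "Y \<in> carrier_mat n n" "H = H * (A * H) * Y"
    using right_factor_if_rank_mult_eq[OF H mult_carrier_mat[OF A H]] rk A H by auto
  obtain W where W: "W \<in> carrier_mat n n" "H = W * ((H * A) * H)"
    using left_factor_if_rank_mult_eq[OF H mult_carrier_mat[OF H A]] rk by auto
  define X where "X = W * H"
  have X: "X \<in> carrier_mat n n" unfolding X_def using W(1) H by simp
  have "X = W * (H * (A * H) * Y)" unfolding X_def by (rule arg_cong[OF Y(2)])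
  also have "\<dots> = (W * ((H * A) * H)) * Y" using A H Y(1) W(1) by simp
  finally have XY: "X = H * Y" unfolding W(2)[symmetric] .
  have "H * (A * X) = H * (A * H) * Y" unfolding XY using Y(1) A H by simp
  hence HAX: "H * (A * X) = H" unfolding Y(2)[symmetric] .
  have "X * A * H = W * ((H * A) * H)" unfolding X_def using W(1) A H by simp
  hence XAH: "X * A * H = H" unfolding W(2)[symmetric] .
  \<comment> \<open>With \<open>B = A X\<close> and \<open>B'\<close> its adjoint, the relation \<open>H A X = H\<close> gives \<open>B' = B' B\<close>, whose right side is self-adjoint.\<close>
  have sa1: "minkowski_adjoint (A * X) = A * X"
  proof -
    let ?X = "minkowski_adjoint X"
    have Xc: "?X \<in> carrier_mat n n" by (rule minkowski_adjoint_carrier[OF X])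
    have e: "minkowski_adjoint (A * X) = ?X * H" unfolding H_def by (rule minkowski_adjoint_mult[OF A X])
    have "?X * H = ?X * H * (A * X)" using HAX A X H Xc by simp
    hence *: "minkowski_adjoint (A * X) = minkowski_adjoint (A * X) * (A * X)" using e by simp
    have AX: "A * X \<in> carrier_mat n n" using A X by simp
    have "minkowski_adjoint (minkowski_adjoint (A * X)) = minkowski_adjoint (minkowski_adjoint (A * X) * (A * X))"
      using * by simp
    also have "\<dots> = minkowski_adjoint (A * X) * (A * X)"
      using minkowski_adjoint_mult[OF minkowski_adjoint_carrier[OF AX] AX] minkowski_adjoint_adjoint[OF AX] by simp
    finally show ?thesis using * minkowski_adjoint_adjoint[OF AX] by simp
  qed
  \<comment> \<open>In the same way, \<open>X A H = H\<close> gives \<open>B' = B B'\<close> for \<open>B = X A\<close>.\<close>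
  have sa2: "minkowski_adjoint (X * A) = X * A"
  proof -
    let ?X = "minkowski_adjoint X"
    have Xc: "?X \<in> carrier_mat n n" by (rule minkowski_adjoint_carrier[OF X])
    have e: "minkowski_adjoint (X * A) = H * ?X" unfolding H_def by (rule minkowski_adjoint_mult[OF X A])
    have "H * ?X = X * A * H * ?X" using XAH by simp
    also have "\<dots> = X * A * (H * ?X)" using A X H Xc by simp
    finally have *: "minkowski_adjoint (X * A) = (X * A) * minkowski_adjoint (X * A)" using e by simp
    have XA: "X * A \<in> carrier_mat n n" using A X by simp
    have "minkowski_adjoint (minkowski_adjoint (X * A)) = minkowski_adjoint ((X * A) * minkowski_adjoint (X * A))"
      using * by simp
    also have "\<dots> = (X * A) * minkowski_adjoint (X * A)"
      using minkowski_adjoint_mult[OF XA minkowski_adjoint_carrier[OF XA]] minkowski_adjoint_adjoint[OF XA] by simp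
    finally show ?thesis using * minkowski_adjoint_adjoint[OF XA] by simp
  qed
  have "A = minkowski_adjoint (H * (A * X))" unfolding HAX HA ..
  also have "\<dots> = A * X * A"
    using minkowski_adjoint_mult[of H n "A * X"] H A X sa1 HA by simp
  finally have inner: "A * X * A = A" ..
  have "X * A * X = X * A * (H * Y)" using XY by simp
  also have "\<dots> = X * A * H * Y" using A H X Y(1) by simp
  also have "\<dots> = X" by (simp only: XAH XY[symmetric])
  finally have "X * A * X = X" .
  with inner sa1 sa2 X A show ?thesis unfolding is_minkowski_inverse_def by auto
qed

text \<open>Penrose's argument: \<open>A X\<close> and \<open>A Y\<close> are self-adjoint idempotents that fix each other on the
  left, hence equal; likewise \<open>X A\<close> and \<open>Y A\<close>, on the right.\<close>

lemma is_minkowski_inverse_unique: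
  assumes A: "A \<in> carrier_mat n n" and X: "is_minkowski_inverse A X" and Y: "is_minkowski_inverse A Y"
  shows "X = Y"
proof -
  note [simp] = assoc_mult_mat[of _ n n _ n _ n] mult_carrier_mat[of _ n n _ n]
  have x: "X \<in> carrier_mat n n" "A * X * A = A" "X * A * X = X"
      "minkowski_adjoint (A * X) = A * X" "minkowski_adjoint (X * A) = X * A"
    and y: "Y \<in> carrier_mat n n" "A * Y * A = A" "Y * A * Y = Y"
      "minkowski_adjoint (A * Y) = A * Y" "minkowski_adjoint (Y * A) = Y * A"
    using X Y A unfolding is_minkowski_inverse_def by auto
  have "A * X = (A * Y) * (A * X)" using y(2) A x(1) y(1) assoc_mult_mat[of "A * Y" n n A n X n] by simp
  also have "\<dots> = minkowski_adjoint ((A * X) * (A * Y))"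
    using minkowski_adjoint_mult[of "A * X" n "A * Y"] A x y by simp
  also have "(A * X) * (A * Y) = A * Y" using x(2) A x(1) y(1) assoc_mult_mat[of "A * X" n n A n Y n] by simp
  finally have AX: "A * X = A * Y" using y by simp
  have "X * A = (X * A) * (Y * A)" using y(2) A x(1) y(1) by simp
  also have "\<dots> = minkowski_adjoint ((Y * A) * (X * A))"
    using minkowski_adjoint_mult[of "Y * A" n "X * A"] A x y by simp
  also have "(Y * A) * (X * A) = Y * A" using x(2) A x(1) y(1) by simp
  finally have XA: "X * A = Y * A" using y by simp
  have "X = X * (A * X)" using x A by simp
  also have "\<dots> = X * A * Y" unfolding AX using A x y by simp
  also have "\<dots> = Y" unfolding XA by (rule y)
  finally show ?thesis .
qed

lemma is_minkowski_inverse_minkowski_inverse: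
  assumes "A \<in> carrier_mat n n"
    and "mat_rank (minkowski_adjoint A * A * minkowski_adjoint A) = mat_rank A"
  shows "is_minkowski_inverse A (minkowski_inverse A)"
  unfolding minkowski_inverse_def
  using is_minkowski_inverse_exists[OF assms] is_minkowski_inverse_unique[OF assms(1)] by (metis theI)

section \<open>Characterizations of the DMP inverse\<close>

text \<open>The columns of \<open>N - 1\<close> lie in the null space of \<open>P\<close>, hence in that of \<open>X\<close>.\<close>

lemma mat_kernel_subset_imp_mult_eq:
  fixes P X N :: "complex mat"
  assumes P: "P \<in> carrier_mat n n" and X: "X \<in> carrier_mat n n" and N: "N \<in> carrier_mat n n"
    and sub: "mat_kernel P \<subseteq> mat_kernel X" and eq: "P * N = P"
  shows "X * N = X"
proof (rule mat_col_eqI)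
  fix j assume "j < dim_col X"
  hence j: "j < n" using X by simp
  let ?e = "unit_vec n j" and ?c = "col N j"
  have c: "?c \<in> carrier_vec n" using N by auto
  have ce: "?c - ?e \<in> carrier_vec n" using c by auto
  note u = mult_mat_unit_vec[OF _ j]
  have PN: "P *\<^sub>v ?c = col P j" using col_mult[OF P N] eq j P N by (metis col_mult2)
  have "P *\<^sub>v (?c - ?e) = 0\<^sub>v n"
    using mult_minus_distrib_mat_vec[OF P c, of ?e] u[OF P] PN P by auto
  hence "X *\<^sub>v (?c - ?e) = 0\<^sub>v n" using sub mat_kernelI[OF P ce] mat_kernelD(2)[OF X] by blast
  hence "X *\<^sub>v ?c - col X j = 0\<^sub>v n" using mult_minus_distrib_mat_vec[OF X c, of ?e] u[OF X] by auto
  hence "X *\<^sub>v ?c = col X j" using X c j by (auto intro!: eq_vecI simp: vec_eq_iff)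
  thus "col (X * N) j = col X j" using X N j by (metis col_mult2)
qed (use X N in auto)


text \<open>Here \<open>D\<close> is the Drazin inverse of \<open>A\<close>, and \<open>M\<close> may be any reflexive generalized inverse. The
  auxiliary \<open>E = D ^ (k + 1)\<close> makes \<open>D\<close> visibly a left and a right multiple of \<open>P = A ^ k\<close>; using
  \<open>D A P = P\<close> instead of cancelling powers treats \<open>k = 0\<close> together with the other cases.\<close>

lemma dmp_characterizations:
  assumes A: "A \<in> carrier_mat n n" and X: "X \<in> carrier_mat n n"
    and D: "D \<in> carrier_mat n n" and M: "M \<in> carrier_mat n n"
    and outer: "D * A * D = D" and cD: "A * D = D * A" and ind: "A ^\<^sub>m (k + 1) * D = A ^\<^sub>m k"
    and AMA: "A * M * A = A" and MAM: "M * A * M = M"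
  shows dmp_iff_range_drazin:
      "X = D * A * M \<longleftrightarrow> mat_range X \<subseteq> mat_range (A ^\<^sub>m k) \<and> D * X = D * M"
    and dmp_iff_range_power:
      "X = D * A * M \<longleftrightarrow> mat_range X \<subseteq> mat_range (A ^\<^sub>m k) \<and> A ^\<^sub>m k * X = A ^\<^sub>m k * M"
    and dmp_iff_kernel_projector:
      "X = D * A * M \<longleftrightarrow> mat_kernel (A ^\<^sub>m k * M) \<subseteq> mat_kernel X \<and> X * A = A * D"
    and dmp_iff_kernel_power:
      "X = D * A * M \<longleftrightarrow> mat_kernel (A ^\<^sub>m k * M) \<subseteq> mat_kernel X \<and> X * A ^\<^sub>m (k + 1) = A ^\<^sub>m k"
proof -
  note [simp] = assoc_mult_mat[of _ n n _ n _ n] mult_carrier_mat[of _ n n _ n]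
  define P where "P = A ^\<^sub>m k"
  define E where "E = D ^\<^sub>m (k + 1)"
  have P: "P \<in> carrier_mat n n" unfolding P_def using A by simp
  have E: "E \<in> carrier_mat n n" unfolding E_def using D by simp
  note c = A X D M P E
  have PA: "A ^\<^sub>m (k + 1) = P * A" and cP: "P * A = A * P" and PD: "P * D = D * P"
    unfolding P_def using pow_mat_commute[OF A A refl] pow_mat_commute[OF A D cD] by auto
  have cE: "A * E = E * A" unfolding E_def by (rule pow_mat_commute[OF D A cD[symmetric], symmetric])
  have DPE: "D = P * E" unfolding P_def E_def by (rule commuting_outer_inverse_pow[OF A D outer cD])
  have PE: "P * E = E * P" unfolding P_def by (rule pow_mat_commute[OF A E cE])
  have ind': "P * A * D = P" using ind unfolding PA P_def[symmetric] .
  have proj: "D * A * P = P"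
  proof -
    have "D * A * P = D * P * A" using c cP by simp
    also have "\<dots> = P * (D * A)" unfolding PD[symmetric] using c by simp
    also have "\<dots> = P" unfolding cD[symmetric] using ind' c by simp
    finally show ?thesis .
  qed
  have range: "D * A * X = X" if sub: "mat_range X \<subseteq> mat_range P"
  proof -
    obtain Y where Y: "Y \<in> carrier_mat n n" "X = P * Y"
      using mat_range_subset_imp_factor[OF X P sub] .
    have "D * A * X = D * A * P * Y" unfolding Y(2) using c Y(1) by simp
    thus ?thesis unfolding proj Y(2) .
  qed
  have range_dmp: "mat_range (D * A * M) \<subseteq> mat_range P"
  proof -
    have "D * A * M = P * (E * (A * M))" unfolding DPE using c by simp
    thus ?thesis using mat_range_mult_subset[OF P, of "E * (A * M)" n] c by simp
  qed
  have kernel: "X * N = X"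
    if "mat_kernel (P * M) \<subseteq> mat_kernel X" "N \<in> carrier_mat n n" "P * M * N = P * M" for N
    using mat_kernel_subset_imp_mult_eq[OF _ X that(2,1,3)] c by simp
  have kernel_dmp: "mat_kernel (P * M) \<subseteq> mat_kernel (D * A * M)"
  proof -
    have "D * A * M = E * P * A * M" unfolding DPE PE ..
    also have "\<dots> = E * A * (P * M)" using c cP by simp
    finally show ?thesis using mat_kernel_mult_subset[of "P * M" n n "E * A" n] c by simp
  qed
  have dmpA: "D * A * M * A = A * D"
  proof -
    have "D * A * M * A = D * (A * M * A)" using c by simp
    thus ?thesis unfolding AMA cD .
  qed
  have PDA: "P * (D * A) = P" unfolding cD[symmetric] using ind' c by simp
  have PMA: "P * M * A = P"
  proof -
    have "P * M * A = P * (D * A) * M * A" unfolding PDA ..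
    also have "\<dots> = P * (D * (A * M * A))" using c by simp
    also have "\<dots> = P" unfolding AMA PDA ..
    finally show ?thesis .
  qed
  have DPAE: "E * (A * P) = D * A"
    unfolding cP[symmetric] DPE PE using c by simp
  show "X = D * A * M \<longleftrightarrow> mat_range X \<subseteq> mat_range (A ^\<^sub>m k) \<and> D * X = D * M"
  proof (fold P_def, intro iffI conjI)
    assume X: "X = D * A * M"
    show "mat_range X \<subseteq> mat_range P" unfolding X by (rule range_dmp)
    have "D * X = D * (D * A) * M" unfolding X using c by simp
    also have "\<dots> = D * (A * D) * M" unfolding cD ..
    also have "\<dots> = D * A * D * M" using c by simp
    finally show "D * X = D * M" unfolding outer .
  next
    assume *: "mat_range X \<subseteq> mat_range P \<and> D * X = D * M"
    have "X = A * D * X" unfolding cD using range * by simp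
    also have "\<dots> = A * (D * X)" using c by simp
    also have "\<dots> = A * (D * M)" using * by simp
    also have "\<dots> = A * D * M" using c by simp
    finally show "X = D * A * M" unfolding cD .
  qed
  show "X = D * A * M \<longleftrightarrow> mat_range X \<subseteq> mat_range (A ^\<^sub>m k) \<and> A ^\<^sub>m k * X = A ^\<^sub>m k * M"
  proof (fold P_def, intro iffI conjI)
    assume X: "X = D * A * M"
    show "mat_range X \<subseteq> mat_range P" unfolding X by (rule range_dmp)
    have "P * X = P * (D * A) * M" unfolding X using c by simp
    thus "P * X = P * M" unfolding PDA .
  next
    assume *: "mat_range X \<subseteq> mat_range P \<and> P * X = P * M"
    \<comment> \<open>Expanding \<open>D A\<close> as a left multiple of \<open>A ^ k\<close> exposes \<open>A ^ k X\<close>.\<close>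
    have "X = E * (A * P) * X" unfolding DPAE using range * by simp
    also have "\<dots> = E * (A * (P * X))" using c by simp
    also have "\<dots> = E * (A * (P * M))" using * by simp
    also have "\<dots> = E * (A * P) * M" using c by simp
    finally show "X = D * A * M" unfolding DPAE .
  qed
  show "X = D * A * M \<longleftrightarrow> mat_kernel (A ^\<^sub>m k * M) \<subseteq> mat_kernel X \<and> X * A = A * D"
  proof (fold P_def, intro iffI conjI)
    assume X: "X = D * A * M"
    show "mat_kernel (P * M) \<subseteq> mat_kernel X" unfolding X by (rule kernel_dmp)
    show "X * A = A * D" unfolding X by (rule dmpA)
  next
    assume *: "mat_kernel (P * M) \<subseteq> mat_kernel X \<and> X * A = A * D"
    \<comment> \<open>The null-space condition lets \<open>X\<close> absorb \<open>A M\<close> on the right, which exposes \<open>X A\<close>.\<close>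
    have "P * M * (A * M) = P * (M * A * M)" using c by simp
    hence "X = X * (A * M)" using kernel[of "A * M"] * c unfolding MAM by simp
    also have "\<dots> = X * A * M" using c by simp
    also have "\<dots> = D * A * M" using * cD by simp
    finally show "X = D * A * M" .
  qed
  show "X = D * A * M \<longleftrightarrow> mat_kernel (A ^\<^sub>m k * M) \<subseteq> mat_kernel X \<and> X * A ^\<^sub>m (k + 1) = A ^\<^sub>m k"
  proof (unfold PA, fold P_def, intro iffI conjI)
    assume X: "X = D * A * M"
    show "mat_kernel (P * M) \<subseteq> mat_kernel X" unfolding X by (rule kernel_dmp)
    have "X * (P * A) = D * A * M * A * P" unfolding X cP using c by simp
    thus "X * (P * A) = P" unfolding dmpA cD proj .
  next
    assume *: "mat_kernel (P * M) \<subseteq> mat_kernel X \<and> X * (P * A) = P"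
    \<comment> \<open>The absorbed matrix contains \<open>A D = A ^ (k + 1) E\<close>, which exposes \<open>X A ^ (k + 1)\<close>.\<close>
    have "P * M * (A * D * A * M) = P * M * A * (D * A) * M" using c by simp
    also have "\<dots> = P * M" unfolding PMA PDA ..
    finally have "X = X * (A * D * A * M)" using kernel[of "A * D * A * M"] * c by simp
    also have "\<dots> = X * (A * (P * E) * A * M)" unfolding DPE[symmetric] ..
    also have "\<dots> = X * (P * A) * E * A * M" unfolding cP using c by simp
    also have "\<dots> = P * E * A * M" using * by simp
    finally show "X = D * A * M" unfolding DPE[symmetric] .
  qed
qed

theorem theorem4p1:
  fixes A X :: "complex mat" and n k :: nat
  assumes n: "n \<ge> 1"
    and A: "A \<in> carrier_mat n n"
    and X: "X \<in> carrier_mat n n"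
    and k: "mat_index A = k"
    and rank: "mat_rank (minkowski_adjoint A * A * minkowski_adjoint A) = mat_rank A"
  defines "P1 \<equiv> X = m_DMP_inverse A"
    and "P2 \<equiv> mat_range X \<subseteq> mat_range (A ^\<^sub>m k) \<and>
           drazin_inverse A * X = drazin_inverse A * minkowski_inverse A"
    and "P3 \<equiv> mat_range X \<subseteq> mat_range (A ^\<^sub>m k) \<and>
           A ^\<^sub>m k * X = A ^\<^sub>m k * minkowski_inverse A"
    and "P4 \<equiv> mat_kernel (A ^\<^sub>m k * minkowski_inverse A) \<subseteq> mat_kernel X \<and>
           X * A = A * drazin_inverse A"
    and "P5 \<equiv> mat_kernel (A ^\<^sub>m k * minkowski_inverse A) \<subseteq> mat_kernel X \<and>
           X * A ^\<^sub>m (k + 1) = A ^\<^sub>m k"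
  shows "(P1 \<longleftrightarrow> P2) \<and> (P1 \<longleftrightarrow> P3) \<and> (P1 \<longleftrightarrow> P4) \<and> (P1 \<longleftrightarrow> P5)"
proof -
  have D: "is_drazin_inverse A (drazin_inverse A)" by (rule is_drazin_inverse_drazin_inverse[OF A])
  have M: "is_minkowski_inverse A (minkowski_inverse A)"
    by (rule is_minkowski_inverse_minkowski_inverse[OF A rank])
  note D' = D[unfolded is_drazin_inverse_def k] and M' = M[unfolded is_minkowski_inverse_def]
  have "drazin_inverse A \<in> carrier_mat n n" "minkowski_inverse A \<in> carrier_mat n n"
    "drazin_inverse A * A * drazin_inverse A = drazin_inverse A"
    "A * drazin_inverse A = drazin_inverse A * A"
    "A ^\<^sub>m (k + 1) * drazin_inverse A = A ^\<^sub>m k"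
    "A * minkowski_inverse A * A = A"
    "minkowski_inverse A * A * minkowski_inverse A = minkowski_inverse A"
    using D' M' A by auto
  note char = dmp_characterizations[OF A X this]
  show ?thesis
    unfolding P1_def P2_def P3_def P4_def P5_def m_DMP_inverse_def
    by (intro conjI char)
qed

end
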